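(* Let $k$ be a positive real number. The generating function $b_k(x)=\sum_{i=0}^{\infty} b_{k,i}x^{i}$ of the binomial transform $(b_{k,n})_{n\ge 0}$ of the modified $k$-Fibonacci-like sequence is, as a formal power series in $x$, $$b_{k}(x) = \frac{2-2kx}{1-(k+2)x+kx^{2}}.$$
   Context: For a positive real number $k$, the modified $k$-Fibonacci-like sequence $(M_{k,n})_{n\ge 0}$ is defined by $M_{k,0}=M_{k,1}=2$ and $M_{k,n+1}=kM_{k,n}+M_{k,n-1}$ for $n\ge 1$. Its binomial transform $(b_{k,n})_{n\ge 0}$ is defined by $b_{k,n}=\sum_{i=0}^{n}\binom{n}{i}M_{k,i}$. *)

theory Defs
  imports Complex_Main "HOL-Computational_Algebra.Formal_Power_Series"
begin

fun modified_k_fib_like :: "real \<Rightarrow> nat \<Rightarrow> real" where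
  "modified_k_fib_like k 0 = 2"
| "modified_k_fib_like k (Suc 0) = 2"
| "modified_k_fib_like k (Suc (Suc n)) =
     k * modified_k_fib_like k (Suc n) + modified_k_fib_like k n"

definition binomial_transform :: "(nat \<Rightarrow> real) \<Rightarrow> nat \<Rightarrow> real" where
  "binomial_transform a n = (\<Sum>i=0..n. real (n choose i) * a i)"

end

theory Submission
  imports Defs
begin

text \<open>
  Write \<open>S\<close> for the shift of sequences, \<open>(S a) n = a (Suc n)\<close>, and \<open>T\<close> for the binomial transform.
  Pascal's rule says \<open>S T = T (1 + S)\<close>, so whatever \<open>S\<close> does to a sequence, \<open>S - 1\<close> does to its
  transform. The sequence \<open>M\<close> satisfies \<open>S\<^sup>2 M = k S M + M\<close>; hence \<open>b = T M\<close> satisfies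
  \<open>(S - 1)\<^sup>2 b = k (S - 1) b + b\<close>, that is \<open>b (n + 2) = (k + 2) b (n + 1) - k b n\<close>
  (lemma \<open>binomial_transform_fib_like_recurrence\<close>). Multiplying the generating function of \<open>b\<close> by
  \<open>1 - (k + 2) X + k X\<^sup>2\<close> therefore kills every coefficient from degree 2 on, and the initial
  values \<open>b 0 = 2\<close>, \<open>b 1 = 4\<close> leave the numerator \<open>2 + (4 - 2 (k + 2)) X = 2 - 2 k X\<close>.
\<close>

text \<open>Pascal's rule, with the boundary terms absorbed by \<open>n choose Suc n = 0\<close>.\<close>

lemma binomial_transform_Suc:
  "binomial_transform a (Suc n) =
     binomial_transform a n + binomial_transform (\<lambda>i. a (Suc i)) n"
proof -
  have "binomial_transform a (Suc n) =
          a 0 + (\<Sum>i=0..n. real (Suc n choose Suc i) * a (Suc i))"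
    unfolding binomial_transform_def by (subst sum.atLeast0_atMost_Suc_shift) simp
  also have "\<dots> = (a 0 + (\<Sum>i=0..n. real (n choose Suc i) * a (Suc i)))
                 + (\<Sum>i=0..n. real (n choose i) * a (Suc i))"
    by (simp add: sum.distrib algebra_simps)
  also have "a 0 + (\<Sum>i=0..n. real (n choose Suc i) * a (Suc i)) =
               (\<Sum>i=0..Suc n. real (n choose i) * a i)"
    by (subst sum.atLeast0_atMost_Suc_shift) simp
  also have "\<dots> = binomial_transform a n"
    by (simp add: binomial_transform_def)
  finally show ?thesis
    by (simp add: binomial_transform_def)
qed

lemma binomial_transform_linear:
  "binomial_transform (\<lambda>i. c * a i + d * b i) n =
     c * binomial_transform a n + d * binomial_transform b n"
  by (simp add: binomial_transform_def sum.distrib sum_distrib_left algebra_simps)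

lemma binomial_transform_fib_like_recurrence:
  fixes k :: real
  defines "b \<equiv> binomial_transform (modified_k_fib_like k)"
  shows "b (Suc (Suc n)) = (k + 2) * b (Suc n) - k * b n"
proof -
  define M where "M = modified_k_fib_like k"
  define c where "c = binomial_transform (\<lambda>i. M (Suc i))"
  have b_Suc: "b (Suc m) = b m + c m" for m
    unfolding b_def c_def M_def by (rule binomial_transform_Suc)
  have "c (Suc n) = c n + binomial_transform (\<lambda>i. k * M (Suc i) + 1 * M i) n"
    \<comment> \<open>the coefficient 1 is written out to match the linearity lemma\<close>
    by (simp add: c_def binomial_transform_Suc M_def)
  also have "\<dots> = c n + (k * c n + b n)"
    by (subst binomial_transform_linear) (simp add: b_def c_def M_def)
  finally show ?thesis
    by (simp add: b_Suc algebra_simps)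
qed

theorem mainTheorem3:
  fixes k :: real
  assumes "k > 0"
  shows "Abs_fps (binomial_transform (modified_k_fib_like k)) =
    (2 - 2 * fps_const k * fps_X) /
    (1 - fps_const (k + 2) * fps_X + fps_const k * fps_X ^ 2)"
proof -
  define b where "b = binomial_transform (modified_k_fib_like k)"
  define N where "N = fps_const 2 - fps_const (2 * k) * fps_X"
  define D where "D = 1 - fps_const (k + 2) * fps_X + fps_const k * fps_X ^ 2"
  have b0: "b 0 = 2" and b1: "b (Suc 0) = 4"
    by (simp_all add: b_def binomial_transform_def)
  have "Abs_fps b * D = N"
  proof (rule fps_ext)
    fix n
    have expand: "Abs_fps b * D = Abs_fps b - fps_const (k + 2) * (fps_X * Abs_fps b)
                    + fps_const k * (fps_X * (fps_X * Abs_fps b))"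
      by (simp add: D_def algebra_simps power2_eq_square del: fps_const_add)
    consider "n = 0" | "n = Suc 0" | m where "n = Suc (Suc m)"
      by (metis not0_implies_Suc)
    then show "fps_nth (Abs_fps b * D) n = fps_nth N n"
    proof cases
      case 3
      have "b n = (k + 2) * b (Suc m) - k * b m"
        unfolding 3 b_def by (rule binomial_transform_fib_like_recurrence)
      with 3 show ?thesis
        unfolding expand by (simp add: N_def del: fps_const_add)
    qed (unfold expand, simp_all add: N_def b0 b1 del: fps_const_add)
  qed
  moreover have "D \<noteq> 0"
  proof
    assume "D = 0"
    then have "fps_nth D 0 = 0" by simp
    then show False by (simp add: D_def)
  qed
  ultimately have "Abs_fps b = N / D"
    by (metis nonzero_mult_div_cancel_right)
  moreover have "N = 2 - 2 * fps_const k * fps_X"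
    by (simp add: N_def numeral_fps_const)
  ultimately show ?thesis
    by (simp add: b_def D_def)
qed

end
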